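(* Let $\mathcal{C}$ be a finitely aligned left cancellative small category and let $\pi$ be a cover-to-join (equivalently, tight) representation of $\mathrm{ZM}(\mathcal{C})$ in a $C^*$-algebra $B$. Let $\pi_{\tilde t}\colon\mathrm{ZM}(\mathcal{C})\to\mathcal{O}(\mathcal{C})$ be the unique finitely join-preserving representation satisfying $\pi_{\tilde t}(\tau_\alpha)=\tilde t_\alpha$ for all $\alpha\in\mathcal{C}$. Then there is a unique homomorphism $\psi^\pi\colon\mathcal{O}(\mathcal{C})\to B$ such that $\psi^\pi\circ\pi_{\tilde t}=\pi$.
   Context: Small categories: a small category $\mathcal{C}$ is identified with its set of morphisms; $\mathcal{C}^0\subseteq\mathcal{C}$ (nonempty) is the set of vertices (objects, identified with identity morphisms), $r,s\colon\mathcal{C}\to\mathcal{C}^0$ are the range and source maps, and $\alpha\beta$ is defined iff $s(\alpha)=r(\beta)$. $\mathcal{C}$ is left cancellative if $\alpha\beta=\alpha\gamma$ implies $\beta=\gamma$. Write $\alpha\mathcal{C}=\{\alpha\beta: r(\beta)=s(\alpha)\}$ and $v\mathcal{C}=r^{-1}(v)$ for $v\in\mathcal{C}^0$. $\mathcal{C}$ is finitely aligned if for all $\alpha,\beta\in\mathcal{C}$ there is a finite (possibly empty) $F\subseteq\mathcal{C}$ with $\alpha\mathcal{C}\cap\beta\mathcal{C}=\bigcup_{\gamma\in F}\gamma\mathcal{C}$; $\alpha\vee\beta$ denotes any such $F$ that is independent ($\gamma\notin\gamma'\mathcal{C}$ for distinct $\gamma,\gamma'\in F$). $F\subseteq v\mathcal{C}$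 is exhaustive at $v$ if for every $\alpha\in v\mathcal{C}$ there is $\beta\in F$ with $\alpha\mathcal{C}\cap\beta\mathcal{C}\ne\varnothing$. Representations: a representation of $\mathcal{C}$ in a $C^*$-algebra $B$ is a map $T\colon\mathcal{C}\to B$ such that for all $\alpha,\beta$: $T_\alpha^*T_\alpha=T_{s(\alpha)}$; $T_\alpha T_\beta=T_{\alpha\beta}$ if $s(\alpha)=r(\beta)$; $T_\alpha T_\alpha^*T_\beta T_\beta^*=\bigvee_{\gamma\in\alpha\vee\beta}T_\gamma T_\gamma^*$ (join of projections, a priori in $B^{**}$; empty join $=0$). It is covariant if moreover $T_v=\bigvee_{\alpha\in F}T_\alpha T_\alpha^*$ for every $v\in\mathcal{C}^0$ and every finite exhaustive set $F$ at $v$. The Cuntz-Krieger algebra $(\mathcal{O}(\mathcal{C}),\tilde t)$ is universal for covariant representations of $\mathcal{C}$: $\tilde t$ is a covariant representation in $\mathcal{O}(\mathcal{C})$ and for every covariant representation $T$ in $B$ there is a unique homomorphism $\psi_T\colon\mathcal{O}(\mathcal{C})\to B$ with $\psi_T(\tilde t_\alpha)=T_\alpha$. Zigzag maps: for $\alpha\in\mathcal{C}$ let $\tau_\alpha\colon s(\alpha)\mathcal{C}\to\alpha\mathcal{C}$, $\tau_\alpha(\beta)=\alpha\beta$, a bijection with inverse $\sigma_\alpha$. $\mathrm{ZM}(\mathcal{C})$ is the inverse subsemigroup of the symmetric inverse semigroup $I(\mathcal{C})$ (partial bijections of $\mathcal{C}$, composed on the largest possible domain) generated by $\{\tau_\alpha\}_{\alpha\in\mathcal{C}}\cup\{\mathrm{id}_\varnothing\}$.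 A zigzag is a tuple $\zeta=(\alpha_1,\beta_1,\dots,\alpha_n,\beta_n)$ with $r(\alpha_i)=r(\beta_i)$ and $s(\beta_i)=s(\alpha_{i+1})$; $\mathcal{Z}_{\mathcal{C}}$ is the set of zigzags, $\varphi_\zeta=\sigma_{\alpha_1}\tau_{\beta_1}\cdots\sigma_{\alpha_n}\tau_{\beta_n}$, and $A(\zeta)$ is the domain of $\varphi_\zeta$. One has $\mathrm{ZM}(\mathcal{C})=\{\varphi_\zeta:\zeta\in\mathcal{Z}_{\mathcal{C}}\}\cup\{\mathrm{id}_\varnothing\}$, with idempotents $\mathrm{id}_{A(\zeta)}$ and $\mathrm{id}_\varnothing$; its zero element is $\mathrm{id}_\varnothing$. A representation of an inverse semigroup $S$ with zero in a $C^*$-algebra $B$ is a map $\pi\colon S\to B$ with $\pi(st)=\pi(s)\pi(t)$, $\pi(s^* )=\pi(s)^*$ and $\pi(0)=0$. A representation $\pi$ of $\mathrm{ZM}(\mathcal{C})$ is finitely join-preserving if for all $\zeta,\zeta_1,\dots,\zeta_n\in\mathcal{Z}_{\mathcal{C}}$ with $A(\zeta)=\bigcup_{j=1}^nA(\zeta_j)$ one has $\pi(\mathrm{id}_{A(\zeta)})=\bigvee_{j=1}^n\pi(\mathrm{id}_{A(\zeta_j)})$. The natural partial order on $S$ is $s\le t$ iff $s=ss^*t$. A finite subset $C\subseteq S$ is a cover of $a\in S$ if $c\le a$ for every $c\in C$, and for every nonzero $s\in S$ with $s\le a$ there exist $c\in C$ and a nonzero $b\in S$ with $b\le s$ and $b\le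 c$. A representation $\pi$ of $S$ in $B$ is cover-to-join if, whenever $C$ is a cover of $a\in S$, the join of $\pi(C)$ exists and equals $\pi(a)$; explicitly, since $\pi(c)\le\pi(a)$ for $c\in C$, this means $\pi(a)^*\pi(a)=\bigvee_{c\in C}\pi(c)^*\pi(c)$ as projections. *)

theory Defs
  imports Complex_Main
begin

section \<open>Small categories, identified with their sets of morphisms\<close>

record 'c small_cat =
  Mor :: "'c set"
  Obj :: "'c set"
  src :: "'c \<Rightarrow> 'c"
  rng :: "'c \<Rightarrow> 'c"
  cmp :: "'c \<Rightarrow> 'c \<Rightarrow> 'c"

text \<open>The value \<open>cmp C \<alpha> \<beta>\<close> is meaningful only if \<open>src C \<alpha> = rng C \<beta>\<close>.\<close>

locale small_category =
  fixes C :: "'c small_cat"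
  assumes Obj_nonempty: "Obj C \<noteq> {}"
    and Obj_Mor: "Obj C \<subseteq> Mor C"
    and src_Obj: "\<alpha> \<in> Mor C \<Longrightarrow> src C \<alpha> \<in> Obj C"
    and rng_Obj: "\<alpha> \<in> Mor C \<Longrightarrow> rng C \<alpha> \<in> Obj C"
    and src_id: "v \<in> Obj C \<Longrightarrow> src C v = v"
    and rng_id: "v \<in> Obj C \<Longrightarrow> rng C v = v"
    and cmp_closed: "\<lbrakk>\<alpha> \<in> Mor C; \<beta> \<in> Mor C; src C \<alpha> = rng C \<beta>\<rbrakk> \<Longrightarrow> cmp C \<alpha> \<beta> \<in> Mor C"
    and src_cmp: "\<lbrakk>\<alpha> \<in> Mor C; \<beta> \<in> Mor C; src C \<alpha> = rng C \<beta>\<rbrakk> \<Longrightarrow> src C (cmp C \<alpha> \<beta>) = src C \<beta>"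
    and rng_cmp: "\<lbrakk>\<alpha> \<in> Mor C; \<beta> \<in> Mor C; src C \<alpha> = rng C \<beta>\<rbrakk> \<Longrightarrow> rng C (cmp C \<alpha> \<beta>) = rng C \<alpha>"
    and cmp_assoc: "\<lbrakk>\<alpha> \<in> Mor C; \<beta> \<in> Mor C; \<gamma> \<in> Mor C; src C \<alpha> = rng C \<beta>; src C \<beta> = rng C \<gamma>\<rbrakk>
      \<Longrightarrow> cmp C (cmp C \<alpha> \<beta>) \<gamma> = cmp C \<alpha> (cmp C \<beta> \<gamma>)"
    and cmp_src: "\<alpha> \<in> Mor C \<Longrightarrow> cmp C \<alpha> (src C \<alpha>) = \<alpha>"
    and rng_cmp_left: "\<alpha> \<in> Mor C \<Longrightarrow> cmp C (rng C \<alpha>) \<alpha> = \<alpha>"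

locale left_cancellative_small_category = small_category +
  assumes left_cancel: "\<lbrakk>\<alpha> \<in> Mor C; \<beta> \<in> Mor C; \<gamma> \<in> Mor C; src C \<alpha> = rng C \<beta>; src C \<alpha> = rng C \<gamma>;
      cmp C \<alpha> \<beta> = cmp C \<alpha> \<gamma>\<rbrakk> \<Longrightarrow> \<beta> = \<gamma>"

definition principal_ideal :: "'c small_cat \<Rightarrow> 'c \<Rightarrow> 'c set" where
  "principal_ideal C \<alpha> = {cmp C \<alpha> \<beta> | \<beta>. \<beta> \<in> Mor C \<and> rng C \<beta> = src C \<alpha>}"

definition morphisms_into :: "'c small_cat \<Rightarrow> 'c \<Rightarrow> 'c set" where
  "morphisms_into C v = {\<alpha> \<in> Mor C. rng C \<alpha> = v}"

definition finitely_aligned :: "'c small_cat \<Rightarrow> bool" where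
  "finitely_aligned C \<longleftrightarrow> (\<forall>\<alpha>\<in>Mor C. \<forall>\<beta>\<in>Mor C. \<exists>F. finite F \<and> F \<subseteq> Mor C \<and>
     principal_ideal C \<alpha> \<inter> principal_ideal C \<beta> = (\<Union>\<gamma>\<in>F. principal_ideal C \<gamma>))"

definition independent :: "'c small_cat \<Rightarrow> 'c set \<Rightarrow> bool" where
  "independent C F \<longleftrightarrow> (\<forall>\<gamma>\<in>F. \<forall>\<gamma>'\<in>F. \<gamma> \<noteq> \<gamma>' \<longrightarrow> \<gamma> \<notin> principal_ideal C \<gamma>')"

text \<open>The finite sets that may serve as \<open>\<alpha> \<or> \<beta>\<close>; such a set is in general not unique.\<close>

definition min_common_extensions :: "'c small_cat \<Rightarrow> 'c \<Rightarrow> 'c \<Rightarrow> 'c set set" where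
  "min_common_extensions C \<alpha> \<beta> = {F. finite F \<and> F \<subseteq> Mor C \<and> independent C F \<and>
     principal_ideal C \<alpha> \<inter> principal_ideal C \<beta> = (\<Union>\<gamma>\<in>F. principal_ideal C \<gamma>)}"

definition exhaustive_at :: "'c small_cat \<Rightarrow> 'c \<Rightarrow> 'c set \<Rightarrow> bool" where
  "exhaustive_at C v F \<longleftrightarrow> F \<subseteq> morphisms_into C v \<and>
     (\<forall>\<alpha>\<in>morphisms_into C v. \<exists>\<beta>\<in>F. principal_ideal C \<alpha> \<inter> principal_ideal C \<beta> \<noteq> {})"


section \<open>C*-algebras (complex, not necessarily unital)\<close>

record 'a cstar_structure =
  carr :: "'a set"
  add :: "'a \<Rightarrow> 'a \<Rightarrow> 'a" (infixl "\<oplus>\<index>" 65)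
  zero :: 'a ("\<zero>\<index>")
  mul :: "'a \<Rightarrow> 'a \<Rightarrow> 'a" (infixl "\<otimes>\<index>" 70)
  scal :: "complex \<Rightarrow> 'a \<Rightarrow> 'a" (infixr "\<odot>\<index>" 75)
  adj :: "'a \<Rightarrow> 'a"
  nrm :: "'a \<Rightarrow> real"

locale cstar_algebra =
  fixes A :: "'a cstar_structure" (structure)
  assumes add_closed: "\<lbrakk>x \<in> carr A; y \<in> carr A\<rbrakk> \<Longrightarrow> x \<oplus> y \<in> carr A"
    and zero_closed: "\<zero> \<in> carr A"
    and mul_closed: "\<lbrakk>x \<in> carr A; y \<in> carr A\<rbrakk> \<Longrightarrow> x \<otimes> y \<in> carr A"
    and scal_closed: "x \<in> carr A \<Longrightarrow> c \<odot> x \<in> carr A"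
    and adj_closed: "x \<in> carr A \<Longrightarrow> adj A x \<in> carr A"
    and add_assoc: "\<lbrakk>x \<in> carr A; y \<in> carr A; z \<in> carr A\<rbrakk> \<Longrightarrow> (x \<oplus> y) \<oplus> z = x \<oplus> (y \<oplus> z)"
    and add_commute: "\<lbrakk>x \<in> carr A; y \<in> carr A\<rbrakk> \<Longrightarrow> x \<oplus> y = y \<oplus> x"
    and add_zero: "x \<in> carr A \<Longrightarrow> x \<oplus> \<zero> = x"
    and add_neg: "x \<in> carr A \<Longrightarrow> x \<oplus> (- 1) \<odot> x = \<zero>"
    and scal_one: "x \<in> carr A \<Longrightarrow> 1 \<odot> x = x"
    and scal_scal: "x \<in> carr A \<Longrightarrow> c \<odot> (d \<odot> x) = (c * d) \<odot> x"
    and scal_add_left: "x \<in> carr A \<Longrightarrow> (c + d) \<odot> x = c \<odot> x \<oplus> d \<odot> x"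
    and scal_add_right: "\<lbrakk>x \<in> carr A; y \<in> carr A\<rbrakk> \<Longrightarrow> c \<odot> (x \<oplus> y) = c \<odot> x \<oplus> c \<odot> y"
    and mul_assoc: "\<lbrakk>x \<in> carr A; y \<in> carr A; z \<in> carr A\<rbrakk> \<Longrightarrow> (x \<otimes> y) \<otimes> z = x \<otimes> (y \<otimes> z)"
    and mul_add_left: "\<lbrakk>x \<in> carr A; y \<in> carr A; z \<in> carr A\<rbrakk> \<Longrightarrow> (x \<oplus> y) \<otimes> z = x \<otimes> z \<oplus> y \<otimes> z"
    and mul_add_right: "\<lbrakk>x \<in> carr A; y \<in> carr A; z \<in> carr A\<rbrakk> \<Longrightarrow> x \<otimes> (y \<oplus> z) = x \<otimes> y \<oplus> x \<otimes> z"
    and mul_scal_left: "\<lbrakk>x \<in> carr A; y \<in> carr A\<rbrakk> \<Longrightarrow> (c \<odot> x) \<otimes> y = c \<odot> (x \<otimes> y)"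
    and mul_scal_right: "\<lbrakk>x \<in> carr A; y \<in> carr A\<rbrakk> \<Longrightarrow> x \<otimes> (c \<odot> y) = c \<odot> (x \<otimes> y)"
    and adj_adj: "x \<in> carr A \<Longrightarrow> adj A (adj A x) = x"
    and adj_add: "\<lbrakk>x \<in> carr A; y \<in> carr A\<rbrakk> \<Longrightarrow> adj A (x \<oplus> y) = adj A x \<oplus> adj A y"
    and adj_scal: "x \<in> carr A \<Longrightarrow> adj A (c \<odot> x) = cnj c \<odot> adj A x"
    and adj_mul: "\<lbrakk>x \<in> carr A; y \<in> carr A\<rbrakk> \<Longrightarrow> adj A (x \<otimes> y) = adj A y \<otimes> adj A x"
    and nrm_nonneg: "x \<in> carr A \<Longrightarrow> 0 \<le> nrm A x"
    and nrm_zero_iff: "x \<in> carr A \<Longrightarrow> nrm A x = 0 \<longleftrightarrow> x = \<zero>"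
    and nrm_add: "\<lbrakk>x \<in> carr A; y \<in> carr A\<rbrakk> \<Longrightarrow> nrm A (x \<oplus> y) \<le> nrm A x + nrm A y"
    and nrm_scal: "x \<in> carr A \<Longrightarrow> nrm A (c \<odot> x) = cmod c * nrm A x"
    and nrm_mul: "\<lbrakk>x \<in> carr A; y \<in> carr A\<rbrakk> \<Longrightarrow> nrm A (x \<otimes> y) \<le> nrm A x * nrm A y"
    and cstar_identity: "x \<in> carr A \<Longrightarrow> nrm A (adj A x \<otimes> x) = (nrm A x)\<^sup>2"
    and complete: "\<lbrakk>\<forall>n. X n \<in> carr A;
        \<forall>e>0. \<exists>N. \<forall>m\<ge>N. \<forall>n\<ge>N. nrm A (X m \<oplus> (- 1) \<odot> X n) < e\<rbrakk>
      \<Longrightarrow> \<exists>x\<in>carr A. (\<lambda>n. nrm A (X n \<oplus> (- 1) \<odot> x)) \<longlonglongrightarrow> 0"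

text \<open>*-homomorphisms. They are extensional (undefined off the carrier), so that uniqueness of a
  homomorphism can be expressed by equality of functions.\<close>

definition star_hom :: "'a cstar_structure \<Rightarrow> 'b cstar_structure \<Rightarrow> ('a \<Rightarrow> 'b) set" where
  "star_hom A B = {\<psi>. (\<forall>x\<in>carr A. \<psi> x \<in> carr B) \<and> (\<forall>x. x \<notin> carr A \<longrightarrow> \<psi> x = undefined) \<and>
     (\<forall>x\<in>carr A. \<forall>y\<in>carr A. \<psi> (x \<oplus>\<^bsub>A\<^esub> y) = \<psi> x \<oplus>\<^bsub>B\<^esub> \<psi> y) \<and>
     (\<forall>c. \<forall>x\<in>carr A. \<psi> (c \<odot>\<^bsub>A\<^esub> x) = c \<odot>\<^bsub>B\<^esub> \<psi> x) \<and>
     (\<forall>x\<in>carr A. \<forall>y\<in>carr A. \<psi> (x \<otimes>\<^bsub>A\<^esub> y) = \<psi> x \<otimes>\<^bsub>B\<^esub> \<psi> y) \<and>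
     (\<forall>x\<in>carr A. \<psi> (adj A x) = adj B (\<psi> x))}"

definition projections :: "'a cstar_structure \<Rightarrow> 'a set" where
  "projections A = {p \<in> carr A. p \<otimes>\<^bsub>A\<^esub> p = p \<and> adj A p = p}"

definition proj_le :: "'a cstar_structure \<Rightarrow> 'a \<Rightarrow> 'a \<Rightarrow> bool" where
  "proj_le A p q \<longleftrightarrow> p \<otimes>\<^bsub>A\<^esub> q = p"

text \<open>\<open>is_join A P q\<close>: \<open>q\<close> is the least upper bound of \<open>P\<close> among the projections of \<open>A\<close>; the join
  of the empty set is \<open>0\<close>. A join taken in the bidual \<open>A**\<close> could differ from this one only for
  noncommuting projections. Finitely many commuting projections have the join given by
  \<open>p \<or> q = p + q - p q\<close>, both in \<open>A\<close> and in \<open>A**\<close>. All joins below are of this kind: for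
  representations of inverse semigroups because idempotents commute, and for representations of
  categories because the third relation makes the product of any two range projections
  \<open>T\<^sub>\<alpha> T\<^sub>\<alpha>*\<close> and \<open>T\<^sub>\<beta> T\<^sub>\<beta>*\<close> self-adjoint, whichever of the two joins is meant there.\<close>

definition is_join :: "'a cstar_structure \<Rightarrow> 'a set \<Rightarrow> 'a \<Rightarrow> bool" where
  "is_join A P q \<longleftrightarrow> P \<subseteq> projections A \<and> q \<in> projections A \<and> (\<forall>p\<in>P. proj_le A p q) \<and>
     (\<forall>r\<in>projections A. (\<forall>p\<in>P. proj_le A p r) \<longrightarrow> proj_le A q r)"


section \<open>Representations of categories and the Cuntz-Krieger algebra\<close>

definition cat_representation ::
    "'c small_cat \<Rightarrow> 'b cstar_structure \<Rightarrow> ('c \<Rightarrow> 'b) \<Rightarrow> bool" where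
  "cat_representation C B T \<longleftrightarrow>
     (\<forall>\<alpha>\<in>Mor C. T \<alpha> \<in> carr B) \<and>
     (\<forall>\<alpha>\<in>Mor C. adj B (T \<alpha>) \<otimes>\<^bsub>B\<^esub> T \<alpha> = T (src C \<alpha>)) \<and>
     (\<forall>\<alpha>\<in>Mor C. \<forall>\<beta>\<in>Mor C. src C \<alpha> = rng C \<beta> \<longrightarrow> T \<alpha> \<otimes>\<^bsub>B\<^esub> T \<beta> = T (cmp C \<alpha> \<beta>)) \<and>
     (\<forall>\<alpha>\<in>Mor C. \<forall>\<beta>\<in>Mor C. \<forall>F\<in>min_common_extensions C \<alpha> \<beta>.
        is_join B ((\<lambda>\<gamma>. T \<gamma> \<otimes>\<^bsub>B\<^esub> adj B (T \<gamma>)) ` F)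
          ((T \<alpha> \<otimes>\<^bsub>B\<^esub> adj B (T \<alpha>)) \<otimes>\<^bsub>B\<^esub> (T \<beta> \<otimes>\<^bsub>B\<^esub> adj B (T \<beta>))))"

definition covariant_representation ::
    "'c small_cat \<Rightarrow> 'b cstar_structure \<Rightarrow> ('c \<Rightarrow> 'b) \<Rightarrow> bool" where
  "covariant_representation C B T \<longleftrightarrow> cat_representation C B T \<and>
     (\<forall>v\<in>Obj C. \<forall>F. finite F \<and> exhaustive_at C v F \<longrightarrow>
        is_join B ((\<lambda>\<alpha>. T \<alpha> \<otimes>\<^bsub>B\<^esub> adj B (T \<alpha>)) ` F) (T v))"

text \<open>\<open>(A, t)\<close> is the Cuntz-Krieger algebra of \<open>C\<close> with its universal covariant representation.
  HOL cannot quantify over types inside a formula, so the type \<open>'b\<close> of elements of the test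
  algebras is a parameter; the universal property in the usual sense is the conjunction of all
  instances.\<close>

definition Cuntz_Krieger_algebra ::
    "'b itself \<Rightarrow> 'c small_cat \<Rightarrow> 'a cstar_structure \<Rightarrow> ('c \<Rightarrow> 'a) \<Rightarrow> bool" where
  "Cuntz_Krieger_algebra (_ :: 'b itself) C A t \<longleftrightarrow>
     cstar_algebra A \<and> covariant_representation C A t \<and>
     (\<forall>(B :: 'b cstar_structure) T. cstar_algebra B \<and> covariant_representation C B T \<longrightarrow>
        (\<exists>!\<psi>. \<psi> \<in> star_hom A B \<and> (\<forall>\<alpha>\<in>Mor C. \<psi> (t \<alpha>) = T \<alpha>)))"


section \<open>Zigzag maps\<close>

text \<open>Partial bijections are modelled as injective partial functions \<open>'c \<rightharpoonup> 'c\<close>; their composition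
  on the largest possible domain is \<open>(\<circ>\<^sub>m)\<close>, and the empty one is \<open>Map.empty\<close>.\<close>

definition pinv :: "('c \<rightharpoonup> 'c) \<Rightarrow> ('c \<rightharpoonup> 'c)" where
  "pinv f = (\<lambda>y. if y \<in> ran f then Some (THE x. f x = Some y) else None)"

definition id_on :: "'c set \<Rightarrow> ('c \<rightharpoonup> 'c)" where
  "id_on X = (\<lambda>x. if x \<in> X then Some x else None)"

definition tau :: "'c small_cat \<Rightarrow> 'c \<Rightarrow> ('c \<rightharpoonup> 'c)" where
  "tau C \<alpha> = (\<lambda>\<beta>. if \<beta> \<in> morphisms_into C (src C \<alpha>) then Some (cmp C \<alpha> \<beta>) else None)"

abbreviation sigma :: "'c small_cat \<Rightarrow> 'c \<Rightarrow> ('c \<rightharpoonup> 'c)" where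
  "sigma C \<alpha> \<equiv> pinv (tau C \<alpha>)"

inductive_set zigzag_maps :: "'c small_cat \<Rightarrow> ('c \<rightharpoonup> 'c) set" for C :: "'c small_cat" where
  tau: "\<alpha> \<in> Mor C \<Longrightarrow> tau C \<alpha> \<in> zigzag_maps C"
| empty: "Map.empty \<in> zigzag_maps C"
| comp: "\<lbrakk>f \<in> zigzag_maps C; g \<in> zigzag_maps C\<rbrakk> \<Longrightarrow> f \<circ>\<^sub>m g \<in> zigzag_maps C"
| inv: "f \<in> zigzag_maps C \<Longrightarrow> pinv f \<in> zigzag_maps C"

text \<open>The zigzag \<open>(\<alpha>\<^sub>1, \<beta>\<^sub>1, \<dots>, \<alpha>\<^sub>n, \<beta>\<^sub>n)\<close>, \<open>n \<ge> 1\<close>, is the list \<open>[(\<alpha>\<^sub>1, \<beta>\<^sub>1), \<dots>, (\<alpha>\<^sub>n, \<beta>\<^sub>n)]\<close>.\<close>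

definition zigzags :: "'c small_cat \<Rightarrow> ('c \<times> 'c) list set" where
  "zigzags C = {\<zeta>. \<zeta> \<noteq> [] \<and>
     (\<forall>(\<alpha>, \<beta>)\<in>set \<zeta>. \<alpha> \<in> Mor C \<and> \<beta> \<in> Mor C \<and> rng C \<alpha> = rng C \<beta>) \<and>
     (\<forall>i. Suc i < length \<zeta> \<longrightarrow> src C (snd (\<zeta> ! i)) = src C (fst (\<zeta> ! Suc i)))}"

definition zigzag_map :: "'c small_cat \<Rightarrow> ('c \<times> 'c) list \<Rightarrow> ('c \<rightharpoonup> 'c)" where
  "zigzag_map C \<zeta> = foldr (\<lambda>(\<alpha>, \<beta>) f. sigma C \<alpha> \<circ>\<^sub>m tau C \<beta> \<circ>\<^sub>m f) \<zeta> Some"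

definition zigzag_dom :: "'c small_cat \<Rightarrow> ('c \<times> 'c) list \<Rightarrow> 'c set" where
  "zigzag_dom C \<zeta> = dom (zigzag_map C \<zeta>)"


section \<open>Inverse semigroups with zero and their representations\<close>

record 's inv_semigroup0 =
  elems :: "'s set"
  smul :: "'s \<Rightarrow> 's \<Rightarrow> 's"
  sinv :: "'s \<Rightarrow> 's"
  szero :: 's

definition ZM :: "'c small_cat \<Rightarrow> ('c \<rightharpoonup> 'c) inv_semigroup0" where
  "ZM C = \<lparr>elems = zigzag_maps C, smul = (\<circ>\<^sub>m), sinv = pinv, szero = Map.empty\<rparr>"

definition isg_representation ::
    "'s inv_semigroup0 \<Rightarrow> 'b cstar_structure \<Rightarrow> ('s \<Rightarrow> 'b) \<Rightarrow> bool" where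
  "isg_representation S B \<pi> \<longleftrightarrow>
     (\<forall>s\<in>elems S. \<pi> s \<in> carr B) \<and>
     (\<forall>s\<in>elems S. \<forall>u\<in>elems S. \<pi> (smul S s u) = \<pi> s \<otimes>\<^bsub>B\<^esub> \<pi> u) \<and>
     (\<forall>s\<in>elems S. \<pi> (sinv S s) = adj B (\<pi> s)) \<and>
     \<pi> (szero S) = \<zero>\<^bsub>B\<^esub>"

definition nat_le :: "'s inv_semigroup0 \<Rightarrow> 's \<Rightarrow> 's \<Rightarrow> bool" where
  "nat_le S s u \<longleftrightarrow> s = smul S (smul S s (sinv S s)) u"

definition is_cover :: "'s inv_semigroup0 \<Rightarrow> 's set \<Rightarrow> 's \<Rightarrow> bool" where
  "is_cover S K a \<longleftrightarrow> finite K \<and> K \<subseteq> elems S \<and> (\<forall>c\<in>K. nat_le S c a) \<and>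
     (\<forall>s\<in>elems S. s \<noteq> szero S \<and> nat_le S s a \<longrightarrow>
        (\<exists>c\<in>K. \<exists>b\<in>elems S. b \<noteq> szero S \<and> nat_le S b s \<and> nat_le S b c))"

definition cover_to_join_representation ::
    "'s inv_semigroup0 \<Rightarrow> 'b cstar_structure \<Rightarrow> ('s \<Rightarrow> 'b) \<Rightarrow> bool" where
  "cover_to_join_representation S B \<pi> \<longleftrightarrow> isg_representation S B \<pi> \<and>
     (\<forall>a\<in>elems S. \<forall>K. is_cover S K a \<longrightarrow>
        is_join B ((\<lambda>c. adj B (\<pi> c) \<otimes>\<^bsub>B\<^esub> \<pi> c) ` K) (adj B (\<pi> a) \<otimes>\<^bsub>B\<^esub> \<pi> a))"

definition finitely_join_preserving ::
    "'c small_cat \<Rightarrow> 'b cstar_structure \<Rightarrow> (('c \<rightharpoonup> 'c) \<Rightarrow> 'b) \<Rightarrow> bool" where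
  "finitely_join_preserving C B \<pi> \<longleftrightarrow> isg_representation (ZM C) B \<pi> \<and>
     (\<forall>\<zeta>\<in>zigzags C. \<forall>Z. finite Z \<and> Z \<subseteq> zigzags C \<and> zigzag_dom C \<zeta> = (\<Union>\<xi>\<in>Z. zigzag_dom C \<xi>) \<longrightarrow>
        is_join B ((\<lambda>\<xi>. \<pi> (id_on (zigzag_dom C \<xi>))) ` Z) (\<pi> (id_on (zigzag_dom C \<zeta>))))"

end

theory Submission
  imports Defs
begin

text \<open>
  The assignment \<open>T \<alpha> = \<pi> (tau C \<alpha>)\<close> turns a cover-to-join representation \<open>\<pi>\<close> of the inverse
  semigroup of zigzag maps into a covariant representation of the category, and the homomorphism
  wanted is the one that the universal property of the Cuntz-Krieger algebra attaches to \<open>T\<close>.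

  The algebraic relations for \<open>T\<close> are identities between the partial bijections \<open>tau C \<alpha>\<close> and their
  inverses; in particular \<open>T \<alpha> T \<alpha>*\<close> is the image under \<open>\<pi>\<close> of the identity on the right ideal
  \<open>\<alpha>C\<close>. Both join relations then follow once certain families of identities on principal right
  ideals are known to be covers. The point that makes this work (lemma \<open>id_on_cover\<close>) is that the domain of a
  zigzag map is closed under right multiplication. Hence an idempotent \<open>id_on Y\<close> with \<open>x \<in> Y\<close> is
  defined on all of \<open>xC\<close>, so if \<open>xC\<close> meets \<open>\<gamma>C\<close>, then \<open>id_on Y\<close> and \<open>id_on (\<gamma>C)\<close> have a common
  nonzero lower bound. For \<open>\<alpha> \<or> \<beta>\<close> the ideals \<open>\<gamma>C\<close> even exhaust \<open>\<alpha>C \<inter> \<beta>C\<close>, and for an exhaustive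
  set every \<open>xC\<close> meets some \<open>\<gamma>C\<close> by definition.

  Since the maps \<open>tau C \<alpha>\<close> generate the zigzag maps, a homomorphism intertwines the two
  representations of the inverse semigroup as soon as it does so on these generators; this gives
  both halves of the assertion.
\<close>

section \<open>Partial injections\<close>

lemma pinv_eq_Some_iff:
  assumes "inj_on f (dom f)"
  shows "pinv f y = Some x \<longleftrightarrow> f x = Some y"
proof -
  have unique: "x = x'" if "f x = Some y" "f x' = Some y" for x x'
    using assms that by (auto simp: inj_on_def dom_def)
  show ?thesis
  proof (cases "y \<in> ran f")
    case True
    then obtain x' where "f x' = Some y" by (auto simp: ran_def)
    then have "(THE x. f x = Some y) = x'" using unique by blast
    with True \<open>f x' = Some y\<close> show ?thesis using unique by (auto simp: pinv_def)
  next
    case False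
    then show ?thesis by (auto simp: pinv_def ran_def)
  qed
qed

lemma inj_on_pinv:
  assumes "inj_on f (dom f)"
  shows "inj_on (pinv f) (dom (pinv f))"
proof (rule inj_onI)
  fix y y' assume "y \<in> dom (pinv f)" "pinv f y = pinv f y'"
  then obtain x where "pinv f y = Some x" "pinv f y' = Some x"
    by force
  then show "y = y'"
    using pinv_eq_Some_iff[OF assms] by simp
qed

lemma inj_on_map_comp:
  assumes "inj_on f (dom f)" "inj_on g (dom g)"
  shows "inj_on (f \<circ>\<^sub>m g) (dom (f \<circ>\<^sub>m g))"
  using assms
  by (auto simp: inj_on_def dom_def map_comp_def split: option.splits)

lemma map_comp_pinv:
  assumes "inj_on f (dom f)"
  shows "f \<circ>\<^sub>m pinv f = id_on (ran f)"
proof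
  fix y
  show "(f \<circ>\<^sub>m pinv f) y = id_on (ran f) y"
  proof (cases "pinv f y")
    case None
    then show ?thesis by (auto simp: pinv_def id_on_def split: if_splits)
  next
    case (Some x)
    then have "f x = Some y" using pinv_eq_Some_iff[OF assms] by blast
    with Some show ?thesis by (auto simp: id_on_def ran_def)
  qed
qed

lemma pinv_map_comp:
  assumes "inj_on f (dom f)"
  shows "pinv f \<circ>\<^sub>m f = id_on (dom f)"
proof
  fix x
  show "(pinv f \<circ>\<^sub>m f) x = id_on (dom f) x"
  proof (cases "f x")
    case None
    then show ?thesis by (simp add: id_on_def domIff)
  next
    case (Some y)
    then have "pinv f y = Some x" using pinv_eq_Some_iff[OF assms] by blast
    with Some show ?thesis by (auto simp: id_on_def)
  qed
qed

lemma dom_id_on [simp]: "dom (id_on X) = X"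
  by (auto simp: id_on_def dom_def)

lemma ran_id_on [simp]: "ran (id_on X) = X"
  by (auto simp: id_on_def ran_def)

lemma id_on_comp [simp]: "id_on X \<circ>\<^sub>m id_on Y = id_on (X \<inter> Y)"
  by (auto simp: id_on_def map_comp_def)

lemma id_on_eq_empty_iff [simp]: "id_on X = Map.empty \<longleftrightarrow> X = {}"
  by (auto simp: id_on_def fun_eq_iff)

section \<open>Zigzag maps and right multiplication\<close>

context left_cancellative_small_category
begin

lemma self_in_principal_ideal:
  assumes "\<alpha> \<in> Mor C"
  shows "\<alpha> \<in> principal_ideal C \<alpha>"
proof -
  have "cmp C \<alpha> (src C \<alpha>) \<in> principal_ideal C \<alpha>"
    unfolding principal_ideal_def using src_Obj[OF assms] Obj_Mor rng_id by blast
  then show ?thesis by (simp add: cmp_src[OF assms])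
qed

lemma principal_ideal_subset_morphisms_into:
  assumes "\<alpha> \<in> Mor C"
  shows "principal_ideal C \<alpha> \<subseteq> morphisms_into C (rng C \<alpha>)"
  using assms cmp_closed rng_cmp
  by (auto simp: principal_ideal_def morphisms_into_def)

lemma dom_tau: "dom (tau C \<alpha>) = morphisms_into C (src C \<alpha>)"
  by (auto simp: tau_def dom_def)

lemma ran_tau: "ran (tau C \<alpha>) = principal_ideal C \<alpha>"
  by (auto simp: tau_def ran_def principal_ideal_def morphisms_into_def)

lemma inj_on_tau:
  assumes "\<alpha> \<in> Mor C"
  shows "inj_on (tau C \<alpha>) (dom (tau C \<alpha>))"
  unfolding dom_tau
proof (rule inj_onI)
  fix \<beta> \<gamma> assume "\<beta> \<in> morphisms_into C (src C \<alpha>)" "\<gamma> \<in> morphisms_into C (src C \<alpha>)"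
    "tau C \<alpha> \<beta> = tau C \<alpha> \<gamma>"
  then have "\<beta> \<in> Mor C" "\<gamma> \<in> Mor C" "src C \<alpha> = rng C \<beta>" "src C \<alpha> = rng C \<gamma>"
    "cmp C \<alpha> \<beta> = cmp C \<alpha> \<gamma>"
    by (auto simp: tau_def morphisms_into_def)
  then show "\<beta> = \<gamma>"
    by (rule left_cancel[OF assms])
qed

lemma tau_Obj:
  assumes "v \<in> Obj C"
  shows "tau C v = id_on (morphisms_into C v)"
  using assms src_id[OF assms] rng_cmp_left
  by (auto simp: tau_def id_on_def morphisms_into_def fun_eq_iff)

lemma tau_comp:
  assumes "\<alpha> \<in> Mor C" "\<beta> \<in> Mor C" "src C \<alpha> = rng C \<beta>"
  shows "tau C \<alpha> \<circ>\<^sub>m tau C \<beta> = tau C (cmp C \<alpha> \<beta>)"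
  using assms cmp_assoc cmp_closed rng_cmp src_cmp
  by (auto simp: tau_def map_comp_def morphisms_into_def fun_eq_iff)

lemma zigzag_maps_inj_on: "f \<in> zigzag_maps C \<Longrightarrow> inj_on f (dom f)"
  by (induction rule: zigzag_maps.induct)
    (auto simp: inj_on_tau inj_on_pinv inj_on_map_comp)

text \<open>Right multiplication commutes with left multiplication by associativity, hence with every
  map generated by left multiplications and their inverses.\<close>

lemma zigzag_maps_right_equivariant:
  assumes "f \<in> zigzag_maps C" "f x = Some y"
  shows "x \<in> Mor C \<and> y \<in> Mor C \<and> src C x = src C y \<and>
    (\<forall>\<delta>\<in>Mor C. rng C \<delta> = src C x \<longrightarrow> f (cmp C x \<delta>) = Some (cmp C y \<delta>))"
  using assms
proof (induction arbitrary: x y rule: zigzag_maps.induct)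
  case (tau \<alpha>)
  then have "x \<in> Mor C" "rng C x = src C \<alpha>" "y = cmp C \<alpha> x"
    by (auto simp: tau_def morphisms_into_def split: if_splits)
  then show ?case
    using \<open>\<alpha> \<in> Mor C\<close> cmp_closed src_cmp rng_cmp cmp_assoc
    by (simp add: tau_def morphisms_into_def)
next
  case empty
  then show ?case by simp
next
  case (comp f g)
  then obtain z where "g x = Some z" "f z = Some y"
    by (auto simp: map_comp_Some_iff)
  with comp.IH(1)[of z y] comp.IH(2)[of x z] show ?case
    by (auto simp: map_comp_Some_iff)
next
  case (inv f)
  note iff = pinv_eq_Some_iff[OF zigzag_maps_inj_on[OF inv.hyps]]
  from inv.prems have "f y = Some x" by (simp add: iff)
  with inv.IH[of y x] show ?case by (auto simp: iff)
qed

lemma principal_ideal_subset_dom: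
  assumes "f \<in> zigzag_maps C" "x \<in> dom f"
  shows "principal_ideal C x \<subseteq> dom f"
  using assms zigzag_maps_right_equivariant[OF assms(1), of x]
  by (auto simp: principal_ideal_def)

lemma id_on_principal_ideal_zigzag:
  assumes "\<alpha> \<in> Mor C"
  shows "id_on (principal_ideal C \<alpha>) \<in> zigzag_maps C"
  using map_comp_pinv[OF inj_on_tau[OF assms]] zigzag_maps.intros assms
  unfolding ran_tau by metis

lemma nat_le_id_on_iff:
  assumes "s \<in> zigzag_maps C"
  shows "nat_le (ZM C) s (id_on X) \<longleftrightarrow> (\<exists>Y\<subseteq>X. s = id_on Y)"
proof -
  have "nat_le (ZM C) s (id_on X) \<longleftrightarrow> s = id_on (ran s \<inter> X)"
    by (simp add: nat_le_def ZM_def map_comp_pinv[OF zigzag_maps_inj_on[OF assms]])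
  also have "\<dots> \<longleftrightarrow> (\<exists>Y\<subseteq>X. s = id_on Y)"
    by (metis Int_lower2 inf.orderE ran_id_on)
  finally show ?thesis .
qed

section \<open>Covers by principal right ideals\<close>

text \<open>A nonzero element below \<open>id_on X\<close> is the identity on a set that contains some \<open>xC\<close> with
  \<open>x \<in> X\<close>; restricting it to a \<open>\<gamma>C\<close> that meets \<open>xC\<close> gives the required nonzero common lower
  bound.\<close>

lemma id_on_cover:
  assumes F: "finite F" "F \<subseteq> Mor C"
    and below: "\<And>\<gamma>. \<gamma> \<in> F \<Longrightarrow> principal_ideal C \<gamma> \<subseteq> X"
    and meets: "\<And>x. \<lbrakk>x \<in> X; x \<in> Mor C\<rbrakk> \<Longrightarrow> \<exists>\<gamma>\<in>F. principal_ideal C x \<inter> principal_ideal C \<gamma> \<noteq> {}"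
  shows "is_cover (ZM C) ((\<lambda>\<gamma>. id_on (principal_ideal C \<gamma>)) ` F) (id_on X)"
proof -
  let ?P = "principal_ideal C"
  have zigzag: "id_on (?P \<gamma>) \<in> zigzag_maps C" if "\<gamma> \<in> F" for \<gamma>
    using that F id_on_principal_ideal_zigzag by blast
  have "\<exists>\<gamma>\<in>F. \<exists>b\<in>zigzag_maps C. b \<noteq> Map.empty \<and> nat_le (ZM C) b s \<and> nat_le (ZM C) b (id_on (?P \<gamma>))"
    if s: "s \<in> zigzag_maps C" "s \<noteq> Map.empty" "nat_le (ZM C) s (id_on X)" for s
  proof -
    obtain Y where Y: "Y \<subseteq> X" "s = id_on Y"
      using s nat_le_id_on_iff by blast
    then obtain x where "x \<in> Y" using s by auto
    moreover have "x \<in> Mor C"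
      using zigzag_maps_right_equivariant[OF s(1), of x x] Y \<open>x \<in> Y\<close> by (simp add: id_on_def)
    moreover have "?P x \<subseteq> Y"
      using principal_ideal_subset_dom[OF s(1), of x] Y \<open>x \<in> Y\<close> by simp
    ultimately obtain \<gamma> where "\<gamma> \<in> F" and nonempty: "Y \<inter> ?P \<gamma> \<noteq> {}"
      using meets[of x] Y by blast
    have b: "id_on (Y \<inter> ?P \<gamma>) \<in> zigzag_maps C"
      using zigzag_maps.comp[OF s(1) zigzag[OF \<open>\<gamma> \<in> F\<close>]] Y by simp
    then have "nat_le (ZM C) (id_on (Y \<inter> ?P \<gamma>)) s"
      and "nat_le (ZM C) (id_on (Y \<inter> ?P \<gamma>)) (id_on (?P \<gamma>))"
      unfolding Y(2) nat_le_id_on_iff[OF b] by blast+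
    with b nonempty \<open>\<gamma> \<in> F\<close> show ?thesis
      by (intro bexI[of _ \<gamma>] bexI[of _ "id_on (Y \<inter> ?P \<gamma>)"]) auto
  qed
  moreover have "nat_le (ZM C) (id_on (?P \<gamma>)) (id_on X)" if "\<gamma> \<in> F" for \<gamma>
    using nat_le_id_on_iff[OF zigzag[OF that]] below[OF that] by blast
  moreover have "elems (ZM C) = zigzag_maps C" "szero (ZM C) = Map.empty"
    by (simp_all add: ZM_def)
  ultimately show ?thesis
    using F zigzag unfolding is_cover_def by simp blast
qed

section \<open>The covariant representation attached to a cover-to-join representation\<close>

context
  fixes B :: "'b cstar_structure" and \<pi> :: "('a \<rightharpoonup> 'a) \<Rightarrow> 'b"
  assumes rep: "isg_representation (ZM C) B \<pi>"
begin

lemma rep_closed: "f \<in> zigzag_maps C \<Longrightarrow> \<pi> f \<in> carr B"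
  and rep_comp: "f \<in> zigzag_maps C \<Longrightarrow> g \<in> zigzag_maps C \<Longrightarrow> \<pi> (f \<circ>\<^sub>m g) = \<pi> f \<otimes>\<^bsub>B\<^esub> \<pi> g"
  and rep_pinv: "f \<in> zigzag_maps C \<Longrightarrow> \<pi> (pinv f) = adj B (\<pi> f)"
  and rep_empty: "\<pi> Map.empty = \<zero>\<^bsub>B\<^esub>"
  using rep by (auto simp: isg_representation_def ZM_def)

lemma rep_source_projection:
  assumes "f \<in> zigzag_maps C"
  shows "adj B (\<pi> f) \<otimes>\<^bsub>B\<^esub> \<pi> f = \<pi> (id_on (dom f))"
  using rep_comp[OF zigzag_maps.inv[OF assms] assms] rep_pinv[OF assms]
    pinv_map_comp[OF zigzag_maps_inj_on[OF assms]] by simp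

lemma rep_range_projection:
  assumes "f \<in> zigzag_maps C"
  shows "\<pi> f \<otimes>\<^bsub>B\<^esub> adj B (\<pi> f) = \<pi> (id_on (ran f))"
  using rep_comp[OF assms zigzag_maps.inv[OF assms]] rep_pinv[OF assms]
    map_comp_pinv[OF zigzag_maps_inj_on[OF assms]] by simp

end

text \<open>The source projection of the idempotent \<open>id_on (\<gamma>C)\<close> coincides with the range projection of
  \<open>tau C \<gamma>\<close>, so the join provided by a cover is a join of range projections of the generators.\<close>

lemma cover_to_join_principal_ideals:
  assumes ctj: "cover_to_join_representation (ZM C) B \<pi>"
    and X: "id_on X \<in> zigzag_maps C"
    and F: "finite F" "F \<subseteq> Mor C"
    and below: "\<And>\<gamma>. \<gamma> \<in> F \<Longrightarrow> principal_ideal C \<gamma> \<subseteq> X"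
    and meets: "\<And>x. \<lbrakk>x \<in> X; x \<in> Mor C\<rbrakk> \<Longrightarrow> \<exists>\<gamma>\<in>F. principal_ideal C x \<inter> principal_ideal C \<gamma> \<noteq> {}"
  shows "is_join B ((\<lambda>\<gamma>. \<pi> (tau C \<gamma>) \<otimes>\<^bsub>B\<^esub> adj B (\<pi> (tau C \<gamma>))) ` F) (\<pi> (id_on X))"
proof -
  let ?K = "(\<lambda>\<gamma>. id_on (principal_ideal C \<gamma>)) ` F"
  have rep: "isg_representation (ZM C) B \<pi>"
    using ctj by (simp add: cover_to_join_representation_def)
  have "is_cover (ZM C) ?K (id_on X)"
    using F below meets by (rule id_on_cover)
  moreover have "id_on X \<in> elems (ZM C)"
    using X by (simp add: ZM_def)
  ultimately have "is_join B ((\<lambda>c. adj B (\<pi> c) \<otimes>\<^bsub>B\<^esub> \<pi> c) ` ?K)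
      (adj B (\<pi> (id_on X)) \<otimes>\<^bsub>B\<^esub> \<pi> (id_on X))"
    using ctj unfolding cover_to_join_representation_def by blast
  moreover have "(\<lambda>c. adj B (\<pi> c) \<otimes>\<^bsub>B\<^esub> \<pi> c) ` ?K
      = (\<lambda>\<gamma>. \<pi> (tau C \<gamma>) \<otimes>\<^bsub>B\<^esub> adj B (\<pi> (tau C \<gamma>))) ` F"
    unfolding image_image
  proof (rule image_cong[OF refl])
    fix \<gamma> assume "\<gamma> \<in> F"
    then have "\<gamma> \<in> Mor C" using F by blast
    then show "adj B (\<pi> (id_on (principal_ideal C \<gamma>))) \<otimes>\<^bsub>B\<^esub> \<pi> (id_on (principal_ideal C \<gamma>))
        = \<pi> (tau C \<gamma>) \<otimes>\<^bsub>B\<^esub> adj B (\<pi> (tau C \<gamma>))"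
      by (simp add: rep_source_projection[OF rep id_on_principal_ideal_zigzag]
          rep_range_projection[OF rep zigzag_maps.tau] ran_tau)
  qed
  ultimately show ?thesis
    by (simp add: rep_source_projection[OF rep X])
qed

lemma covariant_representation_of_cover_to_join:
  assumes ctj: "cover_to_join_representation (ZM C) B \<pi>"
  shows "covariant_representation C B (\<lambda>\<alpha>. \<pi> (tau C \<alpha>))"
proof -
  have rep: "isg_representation (ZM C) B \<pi>"
    using ctj by (simp add: cover_to_join_representation_def)
  let ?P = "principal_ideal C"
  let ?q = "\<lambda>\<alpha>. \<pi> (tau C \<alpha>) \<otimes>\<^bsub>B\<^esub> adj B (\<pi> (tau C \<alpha>))"
  have source: "adj B (\<pi> (tau C \<alpha>)) \<otimes>\<^bsub>B\<^esub> \<pi> (tau C \<alpha>) = \<pi> (tau C (src C \<alpha>))"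
    if "\<alpha> \<in> Mor C" for \<alpha>
    using that by (simp add: rep_source_projection[OF rep zigzag_maps.tau] dom_tau tau_Obj src_Obj)
  have product: "\<pi> (tau C \<alpha>) \<otimes>\<^bsub>B\<^esub> \<pi> (tau C \<beta>) = \<pi> (tau C (cmp C \<alpha> \<beta>))"
    if "\<alpha> \<in> Mor C" "\<beta> \<in> Mor C" "src C \<alpha> = rng C \<beta>" for \<alpha> \<beta>
    unfolding tau_comp[OF that, symmetric]
    by (simp add: rep_comp[OF rep] zigzag_maps.tau that(1,2))
  have meet: "is_join B (?q ` F) (?q \<alpha> \<otimes>\<^bsub>B\<^esub> ?q \<beta>)"
    if "\<alpha> \<in> Mor C" "\<beta> \<in> Mor C" "F \<in> min_common_extensions C \<alpha> \<beta>" for \<alpha> \<beta> F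
  proof -
    have F: "finite F" "F \<subseteq> Mor C" "?P \<alpha> \<inter> ?P \<beta> = (\<Union>\<gamma>\<in>F. ?P \<gamma>)"
      using that(3) by (auto simp: min_common_extensions_def)
    have zz: "id_on (?P \<alpha>) \<in> zigzag_maps C" "id_on (?P \<beta>) \<in> zigzag_maps C"
      using that id_on_principal_ideal_zigzag by auto
    have "?q \<alpha> \<otimes>\<^bsub>B\<^esub> ?q \<beta> = \<pi> (id_on (?P \<alpha> \<inter> ?P \<beta>))"
      using rep_comp[OF rep zz] that
      by (simp add: rep_range_projection[OF rep zigzag_maps.tau] ran_tau)
    moreover have "is_join B (?q ` F) (\<pi> (id_on (?P \<alpha> \<inter> ?P \<beta>)))"
    proof (rule cover_to_join_principal_ideals[OF ctj _ F(1,2)])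
      show "id_on (?P \<alpha> \<inter> ?P \<beta>) \<in> zigzag_maps C"
        using zigzag_maps.comp[OF zz] by simp
      show "?P \<gamma> \<subseteq> ?P \<alpha> \<inter> ?P \<beta>" if "\<gamma> \<in> F" for \<gamma>
        using that F(3) by blast
      show "\<exists>\<gamma>\<in>F. ?P x \<inter> ?P \<gamma> \<noteq> {}" if "x \<in> ?P \<alpha> \<inter> ?P \<beta>" "x \<in> Mor C" for x
        using that F(3) self_in_principal_ideal by blast
    qed
    ultimately show ?thesis by simp
  qed
  have covariant: "is_join B (?q ` F) (\<pi> (tau C v))"
    if v: "v \<in> Obj C" and F: "finite F" "exhaustive_at C v F" for v F
  proof -
    have F': "F \<subseteq> morphisms_into C v" "F \<subseteq> Mor C"
      using F(2) by (auto simp: exhaustive_at_def morphisms_into_def)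
    have "is_join B (?q ` F) (\<pi> (id_on (morphisms_into C v)))"
    proof (rule cover_to_join_principal_ideals[OF ctj _ F(1) F'(2)])
      show "id_on (morphisms_into C v) \<in> zigzag_maps C"
        using zigzag_maps.tau[of v C] v Obj_Mor by (auto simp: tau_Obj)
      show "?P \<gamma> \<subseteq> morphisms_into C v" if "\<gamma> \<in> F" for \<gamma>
        using that F' principal_ideal_subset_morphisms_into[of \<gamma>]
        by (auto simp: morphisms_into_def)
      show "\<exists>\<gamma>\<in>F. ?P x \<inter> ?P \<gamma> \<noteq> {}" if "x \<in> morphisms_into C v" for x
        using that F(2) by (simp add: exhaustive_at_def)
    qed
    then show ?thesis using v by (simp add: tau_Obj)
  qed
  show ?thesis
    unfolding covariant_representation_def cat_representation_def
    using source product meet covariant rep_closed[OF rep zigzag_maps.tau] by blast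
qed

section \<open>Intertwining on generators\<close>

lemma star_hom_zero:
  assumes "cstar_algebra A" "cstar_algebra B" "\<psi> \<in> star_hom A B"
  shows "\<psi> \<zero>\<^bsub>A\<^esub> = \<zero>\<^bsub>B\<^esub>"
proof -
  have z: "\<zero>\<^bsub>A\<^esub> \<in> carr A" and z': "(- 1) \<odot>\<^bsub>A\<^esub> \<zero>\<^bsub>A\<^esub> \<in> carr A"
    using cstar_algebra.zero_closed[OF assms(1)] cstar_algebra.scal_closed[OF assms(1)] by auto
  have "\<psi> (\<zero>\<^bsub>A\<^esub> \<oplus>\<^bsub>A\<^esub> (- 1) \<odot>\<^bsub>A\<^esub> \<zero>\<^bsub>A\<^esub>) = \<psi> \<zero>\<^bsub>A\<^esub> \<oplus>\<^bsub>B\<^esub> (- 1) \<odot>\<^bsub>B\<^esub> \<psi> \<zero>\<^bsub>A\<^esub>"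
    using assms(3) z z' by (simp add: star_hom_def)
  also have "\<dots> = \<zero>\<^bsub>B\<^esub>"
    using assms(3) z cstar_algebra.add_neg[OF assms(2)] by (simp add: star_hom_def)
  finally show ?thesis
    using cstar_algebra.add_neg[OF assms(1) z] by simp
qed

lemma intertwines_zigzag_maps_iff:
  assumes "cstar_algebra A" "cstar_algebra B"
    and "isg_representation (ZM C) A \<rho>" "isg_representation (ZM C) B \<pi>"
    and "\<psi> \<in> star_hom A B"
  shows "(\<forall>s\<in>zigzag_maps C. \<psi> (\<rho> s) = \<pi> s) \<longleftrightarrow> (\<forall>\<alpha>\<in>Mor C. \<psi> (\<rho> (tau C \<alpha>)) = \<pi> (tau C \<alpha>))"
proof (intro iffI ballI)
  fix s assume gen: "\<forall>\<alpha>\<in>Mor C. \<psi> (\<rho> (tau C \<alpha>)) = \<pi> (tau C \<alpha>)" and "s \<in> zigzag_maps C"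
  from this(2) show "\<psi> (\<rho> s) = \<pi> s"
  proof (induction rule: zigzag_maps.induct)
    case (tau \<alpha>)
    with gen show ?case by simp
  next
    case empty
    then show ?case
      using star_hom_zero[OF assms(1,2,5)] by (simp add: rep_empty[OF assms(3)] rep_empty[OF assms(4)])
  next
    case (comp f g)
    then show ?case
      using assms(5) rep_closed[OF assms(3)]
      by (simp add: rep_comp[OF assms(3)] rep_comp[OF assms(4)] star_hom_def)
  next
    case (inv f)
    then show ?case
      using assms(5) rep_closed[OF assms(3)]
      by (simp add: rep_pinv[OF assms(3)] rep_pinv[OF assms(4)] star_hom_def)
  qed
qed (simp add: zigzag_maps.tau)

end

section \<open>The universal homomorphism\<close>

theorem corollary7p10:
  fixes C :: "'c small_cat"
    and B :: "'b cstar_structure"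
    and OC :: "'a cstar_structure"
    and t :: "'c \<Rightarrow> 'a"
    and \<pi> :: "('c \<rightharpoonup> 'c) \<Rightarrow> 'b"
    and \<pi>\<^sub>t :: "('c \<rightharpoonup> 'c) \<Rightarrow> 'a"
  assumes "left_cancellative_small_category C"
    and "finitely_aligned C"
    and "cstar_algebra B"
    and "cover_to_join_representation (ZM C) B \<pi>"
    and "Cuntz_Krieger_algebra TYPE('b) C OC t"
    and "finitely_join_preserving C OC \<pi>\<^sub>t"
    and "\<forall>\<alpha>\<in>Mor C. \<pi>\<^sub>t (tau C \<alpha>) = t \<alpha>"
  shows "\<exists>!\<psi>. \<psi> \<in> star_hom OC B \<and> (\<forall>s\<in>elems (ZM C). \<psi> (\<pi>\<^sub>t s) = \<pi> s)"
proof -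
  interpret left_cancellative_small_category C by fact
  have rep_t: "isg_representation (ZM C) OC \<pi>\<^sub>t"
    using assms(6) by (simp add: finitely_join_preserving_def)
  have rep: "isg_representation (ZM C) B \<pi>"
    using assms(4) by (simp add: cover_to_join_representation_def)
  have OC: "cstar_algebra OC"
    using assms(5) by (simp add: Cuntz_Krieger_algebra_def)
  have "\<exists>!\<psi>. \<psi> \<in> star_hom OC B \<and> (\<forall>\<alpha>\<in>Mor C. \<psi> (t \<alpha>) = \<pi> (tau C \<alpha>))"
    using assms(3,5) covariant_representation_of_cover_to_join[OF assms(4)]
    unfolding Cuntz_Krieger_algebra_def by blast
  moreover have "(\<forall>s\<in>elems (ZM C). \<psi> (\<pi>\<^sub>t s) = \<pi> s) \<longleftrightarrow> (\<forall>\<alpha>\<in>Mor C. \<psi> (t \<alpha>) = \<pi> (tau C \<alpha>))"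
    if "\<psi> \<in> star_hom OC B" for \<psi>
    using intertwines_zigzag_maps_iff[OF OC assms(3) rep_t rep that] assms(7)
    by (simp add: ZM_def)
  ultimately show ?thesis
    by (simp cong: conj_cong)
qed

end
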